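(* Let $d\ge 2$ and let $X_1,\ldots,X_d$ be i.i.d. jumps with the Pareto density $f_1(x)=\alpha x^{-(\alpha+1)}$, $x\ge 1$, where $\alpha>0$. Then the semiparametric importance sampling estimator $Z=Z(\gamma)$ of $\ell=\ell(\gamma)=\mathbb{P}(X_1+\cdots+X_d>\gamma)$ satisfies, for all $\epsilon>0$, $$\limsup_{\gamma\to\infty}\frac{\mathbb{E}\big[Z^2;\,M_d\le\gamma\big]}{\ell^{2-\epsilon}}=0,$$ where $M_d=\max_{i\le d}X_i$.
   Context: $F(x)=1-x^{-\alpha}$ ($x\ge1$) is the cdf of a jump, $\overline F=1-F$; $F^{*k}$ is the $k$-fold convolution of $F$ and $\overline{F^{*k}}=1-F^{*k}$ (equal to $1$ on negative arguments). Write $f(\mathbf{x})=\prod_{i=1}^d f_1(x_i)$, $S(\mathbf{x})=x_1+\cdots+x_d$, $\ell(\gamma)=\overline{F^{*d}}(\gamma)$. The importance sampling density is $g(\mathbf{x})=\prod_{i=1}^d\pi_i(x_i)$ with $$\pi_i(x)=\frac{f_1(x)\,\overline{F^{*(d-1)}}(\gamma-x)}{\overline{F^{*d}}(\gamma)}$$ (the marginals of the density $\mathbb{I}\{S(\mathbf{x})>\gamma\}f(\mathbf{x})/\ell(\gamma)$). The estimator is $$Z=Z(\gamma)=\mathbb{I}\{S(\mathbf{X})>\gamma\}\frac{f(\mathbf{X})}{g(\mathbf{X})}=\mathbb{I}\{S(\mathbf{X})>\gamma\}\prod_{i=1}^d\frac{\overline{F^{*d}}(\gamma)}{\overline{F^{*(d-1)}}(\gamma-X_i)},\qquad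 \mathbf{X}=(X_1,\ldots,X_d)\sim g,$$ and $\mathbb{E}[Z^2;A]=\mathbb{E}[Z^2\,\mathbb{I}_A]$ is taken with $\mathbf{X}\sim g$. *)

theory Defs
  imports "HOL-Probability.Probability"
begin

definition pareto_density :: "real \<Rightarrow> real \<Rightarrow> real" where
  "pareto_density \<alpha> x = (if 1 \<le> x then \<alpha> * x powr (- (\<alpha> + 1)) else 0)"

definition pareto_law :: "real \<Rightarrow> real measure" where
  "pareto_law \<alpha> = density lborel (\<lambda>x. ennreal (pareto_density \<alpha> x))"

lemma cdf_pareto_law:
  assumes "\<alpha> > 0"
  shows "cdf (pareto_law \<alpha>) x = (if 1 \<le> x then 1 - x powr (- \<alpha>) else 0)"
proof -
  have [measurable]: "pareto_density \<alpha> \<in> borel_measurable borel"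
    unfolding pareto_density_def[abs_def] by measurable
  have eq: "emeasure (pareto_law \<alpha>) {..x}
      = (\<integral>\<^sup>+ y. ennreal (pareto_density \<alpha> y) * indicator {..x} y \<partial>lborel)"
    unfolding pareto_law_def by (subst emeasure_density) auto
  show ?thesis
  proof (cases "1 \<le> x")
    case True
    have "(\<integral>\<^sup>+ y. ennreal (pareto_density \<alpha> y) * indicator {..x} y \<partial>lborel)
        = (\<integral>\<^sup>+ y. ennreal (\<alpha> * y powr (- (\<alpha> + 1))) * indicator {1..x} y \<partial>lborel)"
      by (intro nn_integral_cong) (auto simp: pareto_density_def indicator_def)
    also have "\<dots> = ennreal (- (x powr (- \<alpha>)) - (- (1 powr (- \<alpha>))))"
      using assms True
      by (intro nn_integral_FTC_Icc[where F = "\<lambda>y. - (y powr (- \<alpha>))"])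
         (auto intro!: derivative_eq_intros simp: powr_diff powr_minus field_simps powr_add)
    finally have "emeasure (pareto_law \<alpha>) {..x} = ennreal (1 - x powr (- \<alpha>))"
      using eq by simp
    moreover have "x powr (- \<alpha>) \<le> 1"
      using True assms by (simp add: powr_minus_divide ge_one_powr_ge_zero)
    ultimately show ?thesis
      using True by (simp add: cdf_def measure_def)
  next
    case False
    then have "(\<integral>\<^sup>+ y. ennreal (pareto_density \<alpha> y) * indicator {..x} y \<partial>lborel) = 0"
      by (auto simp: nn_integral_0_iff_AE pareto_density_def indicator_def)
    then show ?thesis using eq False by (simp add: cdf_def measure_def)
  qed
qed

primrec convolution_power :: "nat \<Rightarrow> real measure \<Rightarrow> real measure" where
  "convolution_power 0 \<mu> = return borel 0"
| "convolution_power (Suc k) \<mu> = convolution \<mu> (convolution_power k \<mu>)"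

definition pareto_conv_tail :: "real \<Rightarrow> nat \<Rightarrow> real \<Rightarrow> real" where
  "pareto_conv_tail \<alpha> k x = 1 - cdf (convolution_power k (pareto_law \<alpha>)) x"

text \<open>Vectors of dimension \<^term>\<open>d\<close> are functions on the index set \<^term>\<open>{..<d}\<close>.\<close>

definition pareto_joint_density :: "real \<Rightarrow> nat \<Rightarrow> (nat \<Rightarrow> real) \<Rightarrow> real" where
  "pareto_joint_density \<alpha> d x = (\<Prod>i<d. pareto_density \<alpha> (x i))"

definition sampling_marginal :: "real \<Rightarrow> nat \<Rightarrow> real \<Rightarrow> real \<Rightarrow> real" where
  "sampling_marginal \<alpha> d \<gamma> x =
     pareto_density \<alpha> x * pareto_conv_tail \<alpha> (d - 1) (\<gamma> - x) / pareto_conv_tail \<alpha> d \<gamma>"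

definition sampling_density :: "real \<Rightarrow> nat \<Rightarrow> real \<Rightarrow> (nat \<Rightarrow> real) \<Rightarrow> real" where
  "sampling_density \<alpha> d \<gamma> x = (\<Prod>i<d. sampling_marginal \<alpha> d \<gamma> (x i))"

definition sampling_law :: "real \<Rightarrow> nat \<Rightarrow> real \<Rightarrow> (nat \<Rightarrow> real) measure" where
  "sampling_law \<alpha> d \<gamma> = density (PiM {..<d} (\<lambda>_. lborel)) (\<lambda>x. ennreal (sampling_density \<alpha> d \<gamma> x))"

text \<open>Where \<^const>\<open>sampling_density\<close> vanishes, the likelihood ratio below is 0 by the convention
  \<open>x / 0 = 0\<close>; this set is null for \<^const>\<open>sampling_law\<close>.\<close>

definition sampling_estimator :: "real \<Rightarrow> nat \<Rightarrow> real \<Rightarrow> (nat \<Rightarrow> real) \<Rightarrow> real" where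
  "sampling_estimator \<alpha> d \<gamma> x =
     indicator {x. (\<Sum>i<d. x i) > \<gamma>} x * (pareto_joint_density \<alpha> d x / sampling_density \<alpha> d \<gamma> x)"

text \<open>\<open>E[Z\<^sup>2; M\<^sub>d \<le> \<gamma>]\<close> under \<^const>\<open>sampling_law\<close>, as an element of \<open>[0, \<infinity>]\<close>.\<close>

definition second_moment_max_le :: "real \<Rightarrow> nat \<Rightarrow> real \<Rightarrow> ennreal" where
  "second_moment_max_le \<alpha> d \<gamma> =
     (\<integral>\<^sup>+ x. ennreal ((sampling_estimator \<alpha> d \<gamma> x)\<^sup>2) * indicator {x. Max (x ` {..<d}) \<le> \<gamma>} x
        \<partial>sampling_law \<alpha> d \<gamma>)"

end

theory Submission
  imports Defs
begin

text \<open>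
  Write \<open>T k\<close> for the tail of \<open>F\<^sup>*\<^sup>k\<close> and \<open>w y = max 1 y powr \<alpha>\<close>, so that \<open>T k y \<ge> 1 / w y\<close> for
  \<open>k \<ge> 1\<close>. Since \<open>Z\<^sup>2 g = 1{S > \<gamma>} f \<Prod>\<^sub>i T d \<gamma> / T (d - 1) (\<gamma> - x i)\<close>, the second moment is at most
  \<open>T d \<gamma> ^ d\<close> times the expectation of \<open>\<Prod>\<^sub>i w (\<gamma> - X i)\<close> on \<open>S > \<gamma>\<close> under \<open>f\<close>.
  On that event some \<open>X i\<close> exceeds \<open>\<gamma> / d\<close>; bound the other \<open>d - 1\<close> weights by \<open>\<gamma> powr \<alpha>\<close>.
  Given \<open>X i\<close>, the others must sum to more than \<open>\<gamma> - X i\<close>, which has probability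
  \<open>O(1 / w (\<gamma> - X i))\<close> and cancels the remaining weight. With \<open>T d \<gamma> = O(\<gamma> powr - \<alpha>)\<close> and
  \<open>P(X i > \<gamma> / d) = O(\<gamma> powr - \<alpha>)\<close> the second moment is \<open>O(\<gamma> powr (- 2 * \<alpha>)) = O(\<ell>\<^sup>2)\<close>, and
  \<open>\<ell> powr \<epsilon> \<rightarrow> 0\<close>.
\<close>

section \<open>The Pareto law and its tail\<close>

lemma borel_measurable_pareto_density [measurable]: "pareto_density \<alpha> \<in> borel_measurable borel"
  unfolding pareto_density_def[abs_def] by measurable

lemma pareto_density_nonneg: "\<alpha> > 0 \<Longrightarrow> 0 \<le> pareto_density \<alpha> x"
  by (simp add: pareto_density_def)

lemma sets_pareto_law [measurable_cong, simp]: "sets (pareto_law \<alpha>) = sets borel"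
  by (simp add: pareto_law_def)

lemma space_pareto_law [simp]: "space (pareto_law \<alpha>) = UNIV"
  by (simp add: pareto_law_def)

lemma prob_space_pareto_law:
  assumes "\<alpha> > 0"
  shows "prob_space (pareto_law \<alpha>)"
proof
  have lim: "((\<lambda>y::real. - (y powr (- \<alpha>))) \<longlongrightarrow> - 0) at_top"
    using assms by (intro tendsto_minus tendsto_neg_powr filterlim_ident) auto
  have "emeasure (pareto_law \<alpha>) UNIV = (\<integral>\<^sup>+ y. ennreal (pareto_density \<alpha> y) \<partial>lborel)"
    unfolding pareto_law_def by (subst emeasure_density) auto
  also have "\<dots> = (\<integral>\<^sup>+ y. ennreal (\<alpha> * y powr (- (\<alpha> + 1))) * indicator {1..} y \<partial>lborel)"
    by (intro nn_integral_cong) (auto simp: pareto_density_def indicator_def)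
  also have "\<dots> = ennreal (0 - (- (1 powr (- \<alpha>))))"
    using assms lim
    by (intro nn_integral_FTC_atLeast[where F = "\<lambda>y. - (y powr (- \<alpha>))"])
       (auto intro!: derivative_eq_intros simp: powr_diff powr_minus field_simps powr_add)
  finally show "emeasure (pareto_law \<alpha>) (space (pareto_law \<alpha>)) = 1" by simp
qed

lemma prob_greaterThan_eq_cdf:
  fixes M :: "real measure"
  assumes "prob_space M" "sets M = sets borel"
  shows "measure M {x<..} = 1 - cdf M x"
proof -
  interpret prob_space M by fact
  have "space M = UNIV" using assms sets_eq_imp_space_eq[of M borel] by simp
  moreover have "{x<..} = UNIV - {..x}" by auto
  ultimately show ?thesis using prob_compl[of "{..x}"] assms by (simp add: cdf_def)
qed

text \<open>Truncating at 1 merges both branches of the cdf, since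
  \<open>1 powr (- \<alpha>) = 1\<close>. The same truncation later defines the weights, so that
  tail and weight are exact reciprocals.\<close>

lemma measure_pareto_law_greaterThan:
  assumes "\<alpha> > 0"
  shows "measure (pareto_law \<alpha>) {z<..} = max 1 z powr (- \<alpha>)"
  using prob_greaterThan_eq_cdf[OF prob_space_pareto_law[OF assms], of z] assms
  by (auto simp: cdf_pareto_law max_def)

lemma measure_pareto_law_greaterThan_le:
  assumes "\<alpha> > 0" "z > 0"
  shows "measure (pareto_law \<alpha>) {z<..} \<le> z powr (- \<alpha>)"
  using assms by (simp add: measure_pareto_law_greaterThan powr_mono2')

lemma AE_pareto_law_ge_1: "\<alpha> > 0 \<Longrightarrow> AE x in pareto_law \<alpha>. 1 \<le> x"
  unfolding pareto_law_def by (subst AE_density) (auto simp: pareto_density_def)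

section \<open>Convolution powers and two-sided tail bounds\<close>

lemma convolution_power_pareto_law:
  assumes "\<alpha> > 0"
  shows prob_space_convolution_power_pareto_law: "prob_space (convolution_power k (pareto_law \<alpha>))"
    and sets_convolution_power_pareto_law: "sets (convolution_power k (pareto_law \<alpha>)) = sets borel"
proof (induction k)
  case (Suc k)
  let ?N = "convolution_power k (pareto_law \<alpha>)"
  {
    case 1
    interpret pair_prob_space "pareto_law \<alpha>" ?N
      unfolding pair_prob_space_def pair_sigma_finite_def
      using Suc prob_space_pareto_law[OF assms] by (auto intro: prob_space_imp_sigma_finite)
    note [measurable_cong] = Suc(2)
    show ?case
      by (simp add: convolution_def) (rule prob_space_distr, measurable)
  next
    case 2 then show ?case by simp
  }
qed (auto intro: prob_space_return)

lemma measure_pair_measure_Times: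
  assumes "sigma_finite_measure N" "A \<in> sets M" "B \<in> sets N"
  shows "measure (M \<Otimes>\<^sub>M N) (A \<times> B) = measure M A * measure N B"
  using sigma_finite_measure.emeasure_pair_measure_Times[OF assms]
  by (simp add: measure_def enn2real_mult)

context
  fixes \<alpha> :: real assumes \<alpha>: "\<alpha> > 0"
begin

lemma pareto_conv_tail_eq:
  "pareto_conv_tail \<alpha> k x = measure (convolution_power k (pareto_law \<alpha>)) {x<..}"
  using prob_greaterThan_eq_cdf prob_space_convolution_power_pareto_law[OF \<alpha>]
    sets_convolution_power_pareto_law[OF \<alpha>]
  by (simp add: pareto_conv_tail_def)

lemma borel_measurable_pareto_conv_tail [measurable]:
  "pareto_conv_tail \<alpha> k \<in> borel_measurable borel"
proof -
  interpret prob_space "convolution_power k (pareto_law \<alpha>)"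
    by (rule prob_space_convolution_power_pareto_law[OF \<alpha>])
  \<comment> \<open>The tail is decreasing in its argument; the sign change makes it monotone, and
    monotone functions are Borel.\<close>
  have "mono (\<lambda>x. - pareto_conv_tail \<alpha> k x)"
    by (auto simp: pareto_conv_tail_eq mono_def sets_convolution_power_pareto_law[OF \<alpha>]
        intro!: finite_measure_mono)
  then show ?thesis
    using borel_measurable_mono[of "\<lambda>x. - pareto_conv_tail \<alpha> k x"] by simp
qed

text \<open>Induction: point mass at 0 to start, then each jump adds at least 1. Nonnegativity is
  what lets a single large jump force a large sum.\<close>

lemma convolution_power_pareto_law_ge_0:
  "AE x in convolution_power k (pareto_law \<alpha>). 0 \<le> x"
proof (induction k)
  case 0
  have "AE x in return borel (0::real). 0 \<le> x"
    by (subst AE_return) auto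
  then show ?case unfolding convolution_power.simps .
next
  case (Suc k)
  let ?N = "convolution_power k (pareto_law \<alpha>)"
  interpret N: prob_space ?N by (rule prob_space_convolution_power_pareto_law[OF \<alpha>])
  interpret prob_space "pareto_law \<alpha>" by (rule prob_space_pareto_law[OF \<alpha>])
  interpret pair_sigma_finite "pareto_law \<alpha>" ?N ..
  note [measurable_cong] = sets_convolution_power_pareto_law[OF \<alpha>, of k]
  have "AE x in pareto_law \<alpha>. AE y in ?N. 0 \<le> x + y"
    using AE_pareto_law_ge_1[OF \<alpha>] by eventually_elim (use Suc in eventually_elim, simp)
  then have "AE p in pareto_law \<alpha> \<Otimes>\<^sub>M ?N. 0 \<le> fst p + snd p"
  proof (intro AE_pair_measure)
    show "{p \<in> space (pareto_law \<alpha> \<Otimes>\<^sub>M ?N). 0 \<le> fst p + snd p} \<in> sets (pareto_law \<alpha> \<Otimes>\<^sub>M ?N)"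
      by (rule borel_measurable_le) measurable
  qed simp
  then show ?case
    unfolding convolution_power.simps convolution_def
    by (subst AE_distr_iff) (measurable, auto simp: split_beta)
qed

text \<open>The sum exceeds \<open>y\<close> as soon as the first jump does and the remaining ones
  add up to something nonnegative, which is almost sure. This bounds the denominators of the
  likelihood ratio from below.\<close>

lemma pareto_conv_tail_Suc_ge: "max 1 y powr (- \<alpha>) \<le> pareto_conv_tail \<alpha> (Suc k) y"
proof -
  let ?M = "pareto_law \<alpha>" and ?N = "convolution_power k (pareto_law \<alpha>)"
  interpret N: prob_space ?N by (rule prob_space_convolution_power_pareto_law[OF \<alpha>])
  interpret M: prob_space ?M by (rule prob_space_pareto_law[OF \<alpha>])
  interpret pair_prob_space ?M ?N ..
  note [measurable_cong] = sets_convolution_power_pareto_law[OF \<alpha>, of k]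
  have [simp]: "space ?N = UNIV"
    using sets_eq_imp_space_eq[OF sets_convolution_power_pareto_law[OF \<alpha>, of k]] by simp
  have "measure ?N {0..} = 1"
    by (subst N.prob_eq_1)
       (auto simp: sets_convolution_power_pareto_law[OF \<alpha>] intro: convolution_power_pareto_law_ge_0)
  then have "max 1 y powr (- \<alpha>) = measure (?M \<Otimes>\<^sub>M ?N) ({y<..} \<times> {0..})"
    using \<alpha> by (subst measure_pair_measure_Times)
      (auto intro: prob_space_imp_sigma_finite N.prob_space_axioms
        simp: measure_pareto_law_greaterThan sets_convolution_power_pareto_law)
  also have "\<dots> \<le> measure (?M \<Otimes>\<^sub>M ?N) {p \<in> space (?M \<Otimes>\<^sub>M ?N). y < fst p + snd p}"
  proof (rule finite_measure_mono)
    show "{p \<in> space (?M \<Otimes>\<^sub>M ?N). y < fst p + snd p} \<in> sets (?M \<Otimes>\<^sub>M ?N)"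
      by (rule borel_measurable_less) measurable
  qed (auto simp: space_pair_measure)
  also have "\<dots> = pareto_conv_tail \<alpha> (Suc k) y"
    by (auto simp: pareto_conv_tail_eq convolution_def measure_distr split_beta
        intro!: arg_cong[where f = "measure _"])
  finally show ?thesis .
qed

text \<open>If a sum of two terms exceeds \<open>y\<close>, one of them exceeds \<open>y/2\<close>.
  Each convolution thus replaces \<open>K\<close> by \<open>2 powr \<alpha> * (1 + K)\<close>; the
  start is \<open>K = 0\<close>, because point mass at 0 has no tail beyond a positive
  \<open>y\<close>. Only the order in \<open>y\<close> matters, not the growth of \<open>K\<close>
  with \<open>k\<close>.\<close>

lemma pareto_conv_tail_le: "\<exists>K. \<forall>y>0. pareto_conv_tail \<alpha> k y \<le> K * y powr (- \<alpha>)"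
proof (induction k)
  case 0
  show ?case
    by (auto intro!: exI[of _ 0] simp: pareto_conv_tail_eq measure_return)
next
  case (Suc k)
  then obtain K where K: "\<And>y. y > 0 \<Longrightarrow> pareto_conv_tail \<alpha> k y \<le> K * y powr (- \<alpha>)" by auto
  let ?M = "pareto_law \<alpha>" and ?N = "convolution_power k (pareto_law \<alpha>)"
  interpret N: prob_space ?N by (rule prob_space_convolution_power_pareto_law[OF \<alpha>])
  interpret M: prob_space ?M by (rule prob_space_pareto_law[OF \<alpha>])
  interpret pair_prob_space ?M ?N ..
  note setsN = sets_convolution_power_pareto_law[OF \<alpha>, of k]
  note [measurable_cong] = setsN
  have [simp]: "space ?N = UNIV"
    using sets_eq_imp_space_eq[OF setsN] by simp
  have "pareto_conv_tail \<alpha> (Suc k) y \<le> (2 powr \<alpha> * (1 + K)) * y powr (- \<alpha>)" if "y > 0" for y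
  proof -
    let ?A = "{y/2<..} \<times> UNIV" and ?B = "UNIV \<times> {y/2<..}"
    have AB: "?A \<in> sets (?M \<Otimes>\<^sub>M ?N)" "?B \<in> sets (?M \<Otimes>\<^sub>M ?N)"
      using setsN by (auto intro!: pair_measureI)
    have "pareto_conv_tail \<alpha> (Suc k) y = measure (?M \<Otimes>\<^sub>M ?N) {p \<in> space (?M \<Otimes>\<^sub>M ?N). y < fst p + snd p}"
      by (auto simp: pareto_conv_tail_eq convolution_def measure_distr split_beta
          intro!: arg_cong[where f = "measure _"])
    also have "\<dots> \<le> measure (?M \<Otimes>\<^sub>M ?N) (?A \<union> ?B)"
      using AB by (intro finite_measure_mono) (auto simp: space_pair_measure)
    also have "\<dots> \<le> measure (?M \<Otimes>\<^sub>M ?N) ?A + measure (?M \<Otimes>\<^sub>M ?N) ?B"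
      using AB by (intro measure_Un_le) auto
    also have "\<dots> = measure ?M {y/2<..} + pareto_conv_tail \<alpha> k (y/2)"
      using setsN M.prob_space N.prob_space
      by (subst (1 2) measure_pair_measure_Times)
        (auto intro: prob_space_imp_sigma_finite N.prob_space_axioms simp: pareto_conv_tail_eq)
    also have "\<dots> \<le> (y/2) powr (- \<alpha>) + K * (y/2) powr (- \<alpha>)"
      using that \<alpha> by (intro add_mono measure_pareto_law_greaterThan_le K) auto
    also have "\<dots> = (2 powr \<alpha> * (1 + K)) * y powr (- \<alpha>)"
      using that by (simp add: powr_divide powr_minus field_simps)
    finally show ?thesis .
  qed
  then show ?case by blast
qed

end

section \<open>Union bounds for sums of jumps\<close>

text \<open>Pigeonhole: a sum above \<open>r\<close> has a term above the average
  \<open>r / card I\<close>; a union bound over the terms follows.\<close>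

lemma (in prob_space) prob_sum_greater_le:
  fixes X :: "'i \<Rightarrow> 'a \<Rightarrow> real"
  assumes "finite I" "I \<noteq> {}"
    and [measurable]: "\<And>i. i \<in> I \<Longrightarrow> X i \<in> borel_measurable M"
  shows "prob {\<omega>\<in>space M. r < (\<Sum>i\<in>I. X i \<omega>)}
    \<le> (\<Sum>i\<in>I. prob {\<omega>\<in>space M. r / card I < X i \<omega>})"
proof -
  have "prob {\<omega>\<in>space M. r < (\<Sum>i\<in>I. X i \<omega>)}
    \<le> prob (\<Union>i\<in>I. {\<omega>\<in>space M. r / card I < X i \<omega>})"
  proof (intro finite_measure_mono subsetI)
    fix \<omega> assume \<omega>: "\<omega> \<in> {\<omega>\<in>space M. r < (\<Sum>i\<in>I. X i \<omega>)}"
    have "\<exists>i\<in>I. r / card I < X i \<omega>"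
    proof (rule ccontr)
      assume "\<not> ?thesis"
      then have "(\<Sum>i\<in>I. X i \<omega>) \<le> card I * (r / card I)"
        by (intro sum_bounded_above) (auto simp: not_less)
      with assms \<omega> show False by simp
    qed
    with \<omega> show "\<omega> \<in> (\<Union>i\<in>I. {\<omega>\<in>space M. r / card I < X i \<omega>})" by auto
  qed (use assms(1,3) in \<open>auto intro!: sets.finite_UN\<close>)
  also have "\<dots> \<le> (\<Sum>i\<in>I. prob {\<omega>\<in>space M. r / card I < X i \<omega>})"
    using assms(1) by (intro finite_measure_subadditive_finite) auto
  finally show ?thesis .
qed

text \<open>The union bound gives one factor \<open>card I\<close>, the threshold
  \<open>r / card I\<close> a factor \<open>card I powr \<alpha>\<close>. Stated with
  \<open>max 1 r\<close>, the bound covers every real \<open>r\<close> and cancels against the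
  weight \<open>max 1 r powr \<alpha>\<close>.\<close>

lemma (in prob_space) prob_sum_pareto_greater_le:
  assumes \<alpha>: "\<alpha> > 0" and I: "finite I" "I \<noteq> {}"
    and X [measurable]: "\<And>i. i \<in> I \<Longrightarrow> X i \<in> borel_measurable M"
    and law: "\<And>i. i \<in> I \<Longrightarrow> distr M borel (X i) = pareto_law \<alpha>"
  shows "prob {\<omega>\<in>space M. r < (\<Sum>i\<in>I. X i \<omega>)}
    \<le> card I powr (1 + \<alpha>) * max 1 r powr (- \<alpha>)"
proof -
  let ?n = "real (card I)"
  have n: "?n \<ge> 1" using I by (simp add: Suc_leI card_gt_0_iff)
  have eq: "prob {\<omega>\<in>space M. z < X i \<omega>} = max 1 z powr (- \<alpha>)" if "i \<in> I" for i z
  proof -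
    have "prob {\<omega>\<in>space M. z < X i \<omega>} = measure (distr M borel (X i)) {z<..}"
      using X[OF that] by (subst measure_distr) (auto intro!: arg_cong[where f = prob])
    then show ?thesis using that \<alpha> by (simp add: law measure_pareto_law_greaterThan)
  qed
  have "prob {\<omega>\<in>space M. r < (\<Sum>i\<in>I. X i \<omega>)} \<le> (\<Sum>i\<in>I. prob {\<omega>\<in>space M. r / ?n < X i \<omega>})"
    using I by (intro prob_sum_greater_le) auto
  also have "\<dots> = ?n * max 1 (r / ?n) powr (- \<alpha>)"
    by (simp add: eq)
  \<comment> \<open>Since \<open>?n\<close> is at least 1, it can be moved out of the maximum; the
    decreasing power turns this into an upper bound.\<close>
  also have "max 1 r / ?n \<le> max 1 (r / ?n)"
    using n by (auto simp: max_def field_simps)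
  then have "max 1 (r / ?n) powr (- \<alpha>) \<le> (max 1 r / ?n) powr (- \<alpha>)"
    using n \<alpha> by (intro powr_mono2') auto
  also have "?n * (max 1 r / ?n) powr (- \<alpha>) = ?n powr (1 + \<alpha>) * max 1 r powr (- \<alpha>)"
    using n by (simp add: powr_divide powr_minus powr_add field_simps)
  finally show ?thesis using n by simp
qed

section \<open>Weighted expectations under the product law\<close>

text \<open>Both measures agree on rectangles, where the integrand factorises over the coordinates.
  This is what turns the joint density \<open>f\<close> with respect to Lebesgue measure into the
  law of independent Pareto jumps.\<close>

lemma density_PiM:
  assumes I: "finite I"
    and M: "\<And>i. sigma_finite_measure (M i)" "\<And>i. sigma_finite_measure (density (M i) (f i))"
    and f [measurable]: "\<And>i. f i \<in> borel_measurable (M i)"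
  shows "density (PiM I M) (\<lambda>x. \<Prod>i\<in>I. f i (x i)) = PiM I (\<lambda>i. density (M i) (f i))"
proof -
  interpret M: product_sigma_finite M by (rule product_sigma_finite.intro) (rule M)
  interpret D: product_sigma_finite "\<lambda>i. density (M i) (f i)" by (rule product_sigma_finite.intro) (rule M)
  show ?thesis
  proof (rule D.PiM_eqI[OF I])
    show "sets (density (PiM I M) (\<lambda>x. \<Prod>i\<in>I. f i (x i))) = sets (PiM I (\<lambda>i. density (M i) (f i)))"
      by (simp cong: sets_PiM_cong)
  next
    fix A assume "\<And>i. i \<in> I \<Longrightarrow> A i \<in> sets (density (M i) (f i))"
    then have A [measurable]: "\<And>i. i \<in> I \<Longrightarrow> A i \<in> sets (M i)" by simp
    have "emeasure (density (PiM I M) (\<lambda>x. \<Prod>i\<in>I. f i (x i))) (Pi\<^sub>E I A)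
      = (\<integral>\<^sup>+x. (\<Prod>i\<in>I. f i (x i)) * indicator (Pi\<^sub>E I A) x \<partial>PiM I M)"
      using I A by (intro emeasure_density) (auto intro!: sets_PiM_I_finite)
    also have "\<dots> = (\<integral>\<^sup>+x. (\<Prod>i\<in>I. f i (x i) * indicator (A i) (x i)) \<partial>PiM I M)"
    proof (rule nn_integral_cong)
      fix x assume "x \<in> space (PiM I M)"
      then have "indicator (Pi\<^sub>E I A) x = (\<Prod>i\<in>I. indicator (A i) (x i) :: ennreal)"
        using I by (auto simp: indicator_def space_PiM PiE_iff prod_zero_iff)
      then show "(\<Prod>i\<in>I. f i (x i)) * indicator (Pi\<^sub>E I A) x = (\<Prod>i\<in>I. f i (x i) * indicator (A i) (x i))"
        by (simp add: prod.distrib)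
    qed
    also have "\<dots> = (\<Prod>i\<in>I. \<integral>\<^sup>+x. f i x * indicator (A i) x \<partial>M i)"
      using I A by (intro M.product_nn_integral_prod) auto
    also have "\<dots> = (\<Prod>i\<in>I. emeasure (density (M i) (f i)) (A i))"
      using A by (intro prod.cong) (auto simp: emeasure_density)
    finally show "emeasure (density (PiM I M) (\<lambda>x. \<Prod>i\<in>I. f i (x i))) (Pi\<^sub>E I A)
      = (\<Prod>i\<in>I. emeasure (density (M i) (f i)) (A i))" .
  qed
qed

text \<open>Given \<open>x i = y\<close>, the weight \<open>max 1 (\<gamma> - y) powr \<alpha>\<close> cancels the order of
  the probability that the remaining jumps make up for \<open>\<gamma> - y\<close>.\<close>

lemma nn_integral_pareto_weight_le:
  assumes \<alpha>: "\<alpha> > 0" and I: "finite I" "i \<notin> I" "I \<noteq> {}" and t: "t > 0"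
  shows "(\<integral>\<^sup>+x. ennreal (max 1 (\<gamma> - x i) powr \<alpha>)
        * indicator {x. t < x i \<and> \<gamma> < (\<Sum>j\<in>insert i I. x j)} x \<partial>PiM (insert i I) (\<lambda>_. pareto_law \<alpha>))
    \<le> ennreal (card I powr (1 + \<alpha>) * t powr (- \<alpha>))"
proof -
  let ?\<mu> = "pareto_law \<alpha>" and ?c = "card I powr (1 + \<alpha>)"
  let ?P = "PiM I (\<lambda>_. ?\<mu>)"
  interpret \<mu>: prob_space ?\<mu> by (rule prob_space_pareto_law[OF \<alpha>])
  interpret product_prob_space "\<lambda>_. ?\<mu>" I ..
  interpret P: prob_space ?P by (intro prob_space_PiM) unfold_locales
  \<comment> \<open>The inner integral with coordinate \<open>i\<close> frozen at \<open>y\<close>: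
    the tail bound for the others is applied at \<open>r = \<gamma> - y\<close>, so its power of
    \<open>max 1 (\<gamma> - y)\<close> cancels the weight and leaves a constant.\<close>
  have inner: "(\<integral>\<^sup>+x. ennreal (max 1 (\<gamma> - y) powr \<alpha>)
        * indicator {x. t < y \<and> \<gamma> < y + (\<Sum>j\<in>I. x j)} x \<partial>?P) \<le> ennreal ?c * indicator {t<..} y" for y
  proof (cases "t < y")
    case True
    have "(\<integral>\<^sup>+x. ennreal (max 1 (\<gamma> - y) powr \<alpha>) * indicator {x. t < y \<and> \<gamma> < y + (\<Sum>j\<in>I. x j)} x \<partial>?P)
      = (\<integral>\<^sup>+x. ennreal (max 1 (\<gamma> - y) powr \<alpha>) * indicator {x \<in> space ?P. \<gamma> - y < (\<Sum>j\<in>I. x j)} x \<partial>?P)"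
      using True by (intro nn_integral_cong) (auto simp: indicator_def)
    also have "\<dots> = ennreal (max 1 (\<gamma> - y) powr \<alpha>) * emeasure ?P {x \<in> space ?P. \<gamma> - y < (\<Sum>j\<in>I. x j)}"
      by (intro nn_integral_cmult_indicator) measurable
    also have "\<dots> = ennreal (max 1 (\<gamma> - y) powr \<alpha> * measure ?P {x \<in> space ?P. \<gamma> - y < (\<Sum>j\<in>I. x j)})"
      by (simp add: P.emeasure_eq_measure ennreal_mult)
    also have "\<dots> \<le> ennreal (max 1 (\<gamma> - y) powr \<alpha> * (?c * max 1 (\<gamma> - y) powr (- \<alpha>)))"
    proof (intro ennreal_leI mult_left_mono P.prob_sum_pareto_greater_le[OF \<alpha>])
      show "distr ?P borel (\<lambda>x. x j) = ?\<mu>" if "j \<in> I" for j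
        using distr_PiM_component[of I "\<lambda>_. ?\<mu>" j] that prob_space_pareto_law[OF \<alpha>]
        by (simp cong: distr_cong)
    qed (use I in \<open>auto intro: measurable_PiM_component_rev\<close>)
    also have "\<dots> = ennreal ?c"
      by (simp add: powr_minus field_simps)
    finally show ?thesis using True by simp
  qed simp
  have "(\<integral>\<^sup>+x. ennreal (max 1 (\<gamma> - x i) powr \<alpha>)
        * indicator {x. t < x i \<and> \<gamma> < (\<Sum>j\<in>insert i I. x j)} x \<partial>PiM (insert i I) (\<lambda>_. ?\<mu>))
    = (\<integral>\<^sup>+x. ennreal (max 1 (\<gamma> - x i) powr \<alpha>) * indicator {x \<in> space (PiM (insert i I) (\<lambda>_. ?\<mu>)).
          t < x i \<and> \<gamma> < (\<Sum>j\<in>insert i I. x j)} x \<partial>PiM (insert i I) (\<lambda>_. ?\<mu>))"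
    by (intro nn_integral_cong) (auto simp: indicator_def)
  \<comment> \<open>Tonelli with coordinate \<open>i\<close> outermost.\<close>
  also have "\<dots> = (\<integral>\<^sup>+y. \<integral>\<^sup>+x. ennreal (max 1 (\<gamma> - (x(i := y)) i) powr \<alpha>)
        * indicator {x \<in> space (PiM (insert i I) (\<lambda>_. ?\<mu>)).
          t < x i \<and> \<gamma> < (\<Sum>j\<in>insert i I. x j)} (x(i := y)) \<partial>?P \<partial>?\<mu>)"
    using I by (intro product_nn_integral_insert_rev) measurable
  also have "\<dots> = (\<integral>\<^sup>+y. \<integral>\<^sup>+x. ennreal (max 1 (\<gamma> - y) powr \<alpha>)
        * indicator {x. t < y \<and> \<gamma> < y + (\<Sum>j\<in>I. x j)} x \<partial>?P \<partial>?\<mu>)"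
  proof (intro nn_integral_cong)
    fix x y assume "x \<in> space ?P"
    moreover have "(\<Sum>j\<in>insert i I. (x(i := y)) j) = y + (\<Sum>j\<in>I. x j)"
      using I by (simp add: sum.insert) (rule sum.cong, auto)
    ultimately show "ennreal (max 1 (\<gamma> - (x(i := y)) i) powr \<alpha>)
        * indicator {x \<in> space (PiM (insert i I) (\<lambda>_. ?\<mu>)).
          t < x i \<and> \<gamma> < (\<Sum>j\<in>insert i I. x j)} (x(i := y))
      = ennreal (max 1 (\<gamma> - y) powr \<alpha>) * indicator {x. t < y \<and> \<gamma> < y + (\<Sum>j\<in>I. x j)} x"
      by (auto simp: indicator_def space_PiM PiE_iff extensional_def)
  qed
  also have "\<dots> \<le> (\<integral>\<^sup>+y. ennreal ?c * indicator {t<..} y \<partial>?\<mu>)"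
    by (intro nn_integral_mono inner)
  also have "\<dots> = ennreal (?c * measure ?\<mu> {t<..})"
    by (simp add: nn_integral_cmult_indicator \<mu>.emeasure_eq_measure ennreal_mult)
  also have "\<dots> \<le> ennreal (?c * t powr (- \<alpha>))"
    using t \<alpha> by (intro ennreal_leI mult_left_mono measure_pareto_law_greaterThan_le) auto
  finally show ?thesis .
qed

text \<open>Origin of the constant: \<open>d\<close> choices of the large coordinate,
  \<open>real (d - 1) powr (1 + \<alpha>)\<close> from the sum of the other jumps, and
  \<open>d powr \<alpha>\<close> from the threshold \<open>t = \<gamma> / d\<close>.\<close>

lemma nn_integral_pareto_weights_le:
  assumes \<alpha>: "\<alpha> > 0" and d: "d \<ge> 2" and \<gamma>: "\<gamma> \<ge> 1"
  shows "(\<integral>\<^sup>+x. ennreal (\<Prod>i<d. max 1 (\<gamma> - x i) powr \<alpha>)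
        * indicator {x. \<gamma> < (\<Sum>j<d. x j)} x \<partial>PiM {..<d} (\<lambda>_. pareto_law \<alpha>))
    \<le> ennreal (d * real (d - 1) powr (1 + \<alpha>) * d powr \<alpha> * (\<gamma> powr \<alpha>) ^ (d - 1) * \<gamma> powr (- \<alpha>))"
proof -
  let ?\<mu> = "pareto_law \<alpha>" and ?w = "\<lambda>y. max 1 (\<gamma> - y) powr \<alpha>"
  let ?P = "PiM {..<d} (\<lambda>_. ?\<mu>)" and ?G = "(\<gamma> powr \<alpha>) ^ (d - 1)"
    and ?c = "real (d - 1) powr (1 + \<alpha>)"
  let ?A = "\<lambda>i. {x. \<gamma> / d < x i \<and> \<gamma> < (\<Sum>j<d. x j)}"
  have "AE x in ?P. \<forall>i<d. 1 \<le> x i"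
    using d by (auto intro!: AE_PiM_component simp: AE_all_countable
        prob_space_pareto_law[OF \<alpha>] AE_pareto_law_ge_1[OF \<alpha>])
  \<comment> \<open>Which coordinate is large depends on \<open>x\<close>, so the integrand is
    dominated by the sum over all candidates.\<close>
  then have "(\<integral>\<^sup>+x. ennreal (\<Prod>i<d. ?w (x i)) * indicator {x. \<gamma> < (\<Sum>j<d. x j)} x \<partial>?P)
    \<le> (\<integral>\<^sup>+x. (\<Sum>i<d. ennreal ?G * (ennreal (?w (x i)) * indicator (?A i) x)) \<partial>?P)"
  proof (intro nn_integral_mono_AE, eventually_elim)
    fix x :: "nat \<Rightarrow> real" assume ge1: "\<forall>i<d. 1 \<le> x i"
    show "ennreal (\<Prod>i<d. ?w (x i)) * indicator {x. \<gamma> < (\<Sum>j<d. x j)} x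
      \<le> (\<Sum>i<d. ennreal ?G * (ennreal (?w (x i)) * indicator (?A i) x))"
    proof (cases "\<gamma> < (\<Sum>j<d. x j)")
      case True
      have "\<exists>i<d. \<gamma> / d < x i"
      proof (rule ccontr)
        assume "\<not> ?thesis"
        then have "(\<Sum>i<d. x i) \<le> card {..<d} * (\<gamma> / d)"
          by (intro sum_bounded_above) (meson lessThan_iff not_less)
        with d True show False by simp
      qed
      then obtain i where i: "i < d" "\<gamma> / d < x i" by blast
      \<comment> \<open>Jumps are at least 1 and \<open>\<gamma>\<close> is at least 1, so
        \<open>max 1 (\<gamma> - x j)\<close> never exceeds \<open>\<gamma>\<close>.\<close>
      have "(\<Prod>j\<in>{..<d} - {i}. ?w (x j)) \<le> (\<Prod>j\<in>{..<d} - {i}. \<gamma> powr \<alpha>)"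
        using ge1 \<gamma> \<alpha> by (intro prod_mono) (force intro!: powr_mono2)
      also have "\<dots> = ?G" using i by simp
      finally have "?w (x i) * (\<Prod>j\<in>{..<d} - {i}. ?w (x j)) \<le> ?w (x i) * ?G"
        by (intro mult_left_mono) auto
      moreover have "(\<Prod>j<d. ?w (x j)) = ?w (x i) * (\<Prod>j\<in>{..<d} - {i}. ?w (x j))"
        using i by (intro prod.remove) auto
      ultimately have "(\<Prod>j<d. ?w (x j)) \<le> ?G * ?w (x i)"
        by (metis mult.commute)
      then have "ennreal (\<Prod>j<d. ?w (x j)) * indicator {x. \<gamma> < (\<Sum>j<d. x j)} x
        \<le> ennreal ?G * (ennreal (?w (x i)) * indicator (?A i) x)"
        using True i by (simp add: ennreal_mult[symmetric] ennreal_leI)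
      also have "\<dots> \<le> (\<Sum>i<d. ennreal ?G * (ennreal (?w (x i)) * indicator (?A i) x))"
        using i by (intro member_le_sum) auto
      finally show ?thesis .
    qed simp
  qed
  also have "\<dots> = (\<integral>\<^sup>+x. (\<Sum>i<d. ennreal ?G * (ennreal (?w (x i))
      * indicator {x \<in> space ?P. \<gamma> / d < x i \<and> \<gamma> < (\<Sum>j<d. x j)} x)) \<partial>?P)"
    by (intro nn_integral_cong sum.cong) (auto simp: indicator_def)
  also have "\<dots> = (\<Sum>i<d. ennreal ?G * (\<integral>\<^sup>+x. ennreal (?w (x i))
      * indicator {x \<in> space ?P. \<gamma> / d < x i \<and> \<gamma> < (\<Sum>j<d. x j)} x \<partial>?P))"
    by (subst nn_integral_sum) (auto intro!: sum.cong nn_integral_cmult)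
  also have "\<dots> = (\<Sum>i<d. ennreal ?G * (\<integral>\<^sup>+x. ennreal (?w (x i)) * indicator (?A i) x \<partial>?P))"
    by (intro sum.cong arg_cong2[where f = "(*)"] nn_integral_cong) (auto simp: indicator_def)
  also have "\<dots> \<le> (\<Sum>i<d. ennreal ?G * ennreal (?c * (\<gamma> / d) powr (- \<alpha>)))"
  proof (intro sum_mono mult_left_mono)
    fix i assume "i \<in> {..<d}"
    then have ins: "insert i ({..<d} - {i}) = {..<d}" and card: "card ({..<d} - {i}) = d - 1"
      by auto
    \<comment> \<open>Here \<open>d \<ge> 2\<close> enters: some jump must remain to make up for
      \<open>\<gamma> - x i\<close>.\<close>
    then have ne: "{..<d} - {i} \<noteq> {}" using d by (intro notI) simp
    show "(\<integral>\<^sup>+x. ennreal (?w (x i)) * indicator (?A i) x \<partial>?P) \<le> ennreal (?c * (\<gamma> / d) powr (- \<alpha>))"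
      using d \<gamma> ne by (intro nn_integral_pareto_weight_le[OF \<alpha>, of "{..<d} - {i}" i, unfolded ins card]) auto
  qed simp
  also have "\<dots> = ennreal (d * (?G * (?c * (\<gamma> / d) powr (- \<alpha>))))"
  proof -
    have "(\<Sum>i<d. ennreal a * ennreal b) = ennreal (d * (a * b))" if "0 \<le> a" "0 \<le> b" for a b :: real
      using that by (simp add: ennreal_mult ennreal_of_nat_eq_real_of_nat)
    then show ?thesis by this auto
  qed
  also have "(\<gamma> / d) powr (- \<alpha>) = d powr \<alpha> * \<gamma> powr (- \<alpha>)"
    using \<gamma> by (simp add: powr_divide powr_minus field_simps)
  also have "d * (?G * (?c * (d powr \<alpha> * \<gamma> powr (- \<alpha>)))) = d * ?c * d powr \<alpha> * ?G * \<gamma> powr (- \<alpha>)"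
    by (simp only: ac_simps)
  finally show ?thesis .
qed

section \<open>From the estimator to the weights\<close>

text \<open>One coordinate of \<open>g Z^2\<close>: with \<open>q = p * U / T\<close> one has
  \<open>q * (p / q)^2 = p * T / U\<close>, and \<open>1 / U \<le> w\<close>. If
  \<open>p = 0\<close>, both sides vanish by the convention for division by zero.\<close>

lemma squared_ratio_le:
  fixes p T U w :: real
  assumes "0 \<le> p" "0 < T" "0 < w" "1 / w \<le> U"
  shows "p * U / T * (p / (p * U / T))\<^sup>2 \<le> p * (T * w)"
proof (cases "p = 0")
  case False
  have "0 < 1 / w" using assms by simp
  with assms have U: "0 < U" by linarith
  then have "1 / U \<le> w" using assms by (simp add: field_simps)
  have "p * U / T * (p / (p * U / T))\<^sup>2 = p * (T * (1 / U))"
    using False assms U by (simp add: power2_eq_square field_simps)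
  also have "\<dots> \<le> p * (T * w)"
    using assms \<open>1 / U \<le> w\<close> by (intro mult_left_mono) auto
  finally show ?thesis .
qed simp

text \<open>The constraint \<open>M\<^sub>d \<le> \<gamma>\<close> is dropped at no cost: beyond \<open>\<gamma>\<close> the weight
  \<open>max 1 (\<gamma> - x i) powr \<alpha>\<close> stays equal to 1.\<close>

lemma second_moment_max_le_le_weights:
  assumes \<alpha>: "\<alpha> > 0" and d: "d \<ge> 2"
  shows "second_moment_max_le \<alpha> d \<gamma> \<le> ennreal (pareto_conv_tail \<alpha> d \<gamma> ^ d)
    * (\<integral>\<^sup>+x. ennreal (\<Prod>i<d. max 1 (\<gamma> - x i) powr \<alpha>)
        * indicator {x. \<gamma> < (\<Sum>j<d. x j)} x \<partial>PiM {..<d} (\<lambda>_. pareto_law \<alpha>))"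
proof -
  let ?L = "PiM {..<d} (\<lambda>_. lborel :: real measure)"
  let ?T = "pareto_conv_tail \<alpha>" and ?w = "\<lambda>y. max 1 (\<gamma> - y) powr \<alpha>"
  let ?A = "{x \<in> space ?L. \<gamma> < (\<Sum>j<d. x j)}"
  note [measurable] = borel_measurable_pareto_conv_tail[OF \<alpha>]
  \<comment> \<open>Both \<open>d - 1\<close> and \<open>d\<close> are successors, so the lower tail
    bound applies to the numerator and to the denominator of the sampling marginal.\<close>
  obtain m where m: "d = Suc (Suc m)" using d by (metis add_2_eq_Suc le_Suc_ex)
  have Tge: "1 / max 1 y powr \<alpha> \<le> ?T (d - 1) y" "1 / max 1 y powr \<alpha> \<le> ?T d y" for y
    using pareto_conv_tail_Suc_ge[OF \<alpha>, of y] by (auto simp: m powr_minus_divide)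
  have Tpos: "0 < ?T d y" for y
    by (rule less_le_trans[OF _ Tge(2)]) auto
  have Tnonneg: "0 \<le> ?T (d - 1) y" for y
    by (simp add: pareto_conv_tail_eq[OF \<alpha>])
  have meas [measurable]: "sampling_density \<alpha> d \<gamma> \<in> borel_measurable ?L"
    "sampling_estimator \<alpha> d \<gamma> \<in> borel_measurable ?L"
    unfolding sampling_density_def[abs_def] sampling_estimator_def[abs_def]
      pareto_joint_density_def sampling_marginal_def by measurable
  have point: "ennreal (sampling_density \<alpha> d \<gamma> x) * ennreal ((sampling_estimator \<alpha> d \<gamma> x)\<^sup>2)
    \<le> ennreal (\<Prod>i<d. pareto_density \<alpha> (x i))
      * (ennreal (?T d \<gamma> ^ d) * (ennreal (\<Prod>i<d. ?w (x i)) * indicator ?A x))"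
    if x: "x \<in> space ?L" for x
  proof (cases "\<gamma> < (\<Sum>j<d. x j)")
    case True
    have "sampling_density \<alpha> d \<gamma> x * (sampling_estimator \<alpha> d \<gamma> x)\<^sup>2
      = (\<Prod>i<d. sampling_marginal \<alpha> d \<gamma> (x i))
        * (\<Prod>i<d. pareto_density \<alpha> (x i) / sampling_marginal \<alpha> d \<gamma> (x i))\<^sup>2"
      using True by (simp add: sampling_density_def sampling_estimator_def pareto_joint_density_def
          prod_dividef)
    also have "\<dots> = (\<Prod>i<d. sampling_marginal \<alpha> d \<gamma> (x i)
          * (pareto_density \<alpha> (x i) / sampling_marginal \<alpha> d \<gamma> (x i))\<^sup>2)"
      by (simp only: prod.distrib prod_power_distrib)
    \<comment> \<open>The expression is now a product over coordinates, each bounded by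
      \<open>squared_ratio_le\<close> with \<open>U\<close> the tail of order \<open>d - 1\<close>
      at \<open>\<gamma> - x i\<close>.\<close>
    also have "\<dots> \<le> (\<Prod>i<d. pareto_density \<alpha> (x i) * (?T d \<gamma> * ?w (x i)))"
    proof (intro prod_mono conjI)
      fix i
      have "0 \<le> sampling_marginal \<alpha> d \<gamma> (x i)"
        unfolding sampling_marginal_def
        by (intro divide_nonneg_pos mult_nonneg_nonneg pareto_density_nonneg[OF \<alpha>] Tnonneg Tpos)
      then show "0 \<le> sampling_marginal \<alpha> d \<gamma> (x i)
          * (pareto_density \<alpha> (x i) / sampling_marginal \<alpha> d \<gamma> (x i))\<^sup>2"
        by (intro mult_nonneg_nonneg zero_le_power2)
      show "sampling_marginal \<alpha> d \<gamma> (x i)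
          * (pareto_density \<alpha> (x i) / sampling_marginal \<alpha> d \<gamma> (x i))\<^sup>2
        \<le> pareto_density \<alpha> (x i) * (?T d \<gamma> * ?w (x i))"
        unfolding sampling_marginal_def
        by (rule squared_ratio_le[OF pareto_density_nonneg[OF \<alpha>] Tpos _ Tge(1)]) simp
    qed
    also have "\<dots> = (\<Prod>i<d. pareto_density \<alpha> (x i)) * (?T d \<gamma> ^ d * (\<Prod>i<d. ?w (x i)))"
      by (simp add: prod.distrib)
    finally show ?thesis
      using True x pareto_density_nonneg[OF \<alpha>] Tpos[of \<gamma>]
      by (simp add: ennreal_mult[symmetric] ennreal_mult''[symmetric] ennreal_leI prod_nonneg less_imp_le)
  qed (simp add: sampling_estimator_def)
  have "second_moment_max_le \<alpha> d \<gamma> \<le> (\<integral>\<^sup>+x. ennreal ((sampling_estimator \<alpha> d \<gamma> x)\<^sup>2) \<partial>sampling_law \<alpha> d \<gamma>)"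
    unfolding second_moment_max_le_def by (intro nn_integral_mono) (auto simp: indicator_def)
  also have "\<dots> = (\<integral>\<^sup>+x. ennreal (sampling_density \<alpha> d \<gamma> x)
      * ennreal ((sampling_estimator \<alpha> d \<gamma> x)\<^sup>2) \<partial>?L)"
    unfolding sampling_law_def by (intro nn_integral_density) measurable
  also have "\<dots> \<le> (\<integral>\<^sup>+x. ennreal (\<Prod>i<d. pareto_density \<alpha> (x i))
      * (ennreal (?T d \<gamma> ^ d) * (ennreal (\<Prod>i<d. ?w (x i)) * indicator ?A x)) \<partial>?L)"
    by (intro nn_integral_mono point)
  also have "\<dots> = (\<integral>\<^sup>+x. ennreal (?T d \<gamma> ^ d) * (ennreal (\<Prod>i<d. ?w (x i)) * indicator ?A x)
      \<partial>density ?L (\<lambda>x. ennreal (\<Prod>i<d. pareto_density \<alpha> (x i))))"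
    by (intro nn_integral_density[symmetric]) measurable
  also have "density ?L (\<lambda>x. ennreal (\<Prod>i<d. pareto_density \<alpha> (x i)))
    = PiM {..<d} (\<lambda>_. pareto_law \<alpha>)"
    using density_PiM[of "{..<d}" "\<lambda>_. lborel" "\<lambda>_ x. ennreal (pareto_density \<alpha> x)"]
      prob_space_imp_sigma_finite[OF prob_space_pareto_law[OF \<alpha>]] lborel.sigma_finite_measure_axioms
      pareto_density_nonneg[OF \<alpha>]
    by (simp add: pareto_law_def prod_ennreal)
  also have "(\<integral>\<^sup>+x. ennreal (?T d \<gamma> ^ d) * (ennreal (\<Prod>i<d. ?w (x i)) * indicator ?A x) \<partial>PiM {..<d} (\<lambda>_. pareto_law \<alpha>))
    = ennreal (?T d \<gamma> ^ d) * (\<integral>\<^sup>+x. ennreal (\<Prod>i<d. ?w (x i)) * indicator ?A x \<partial>PiM {..<d} (\<lambda>_. pareto_law \<alpha>))"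
    by (intro nn_integral_cmult) measurable
  also have "\<dots> = ennreal (?T d \<gamma> ^ d) * (\<integral>\<^sup>+x. ennreal (\<Prod>i<d. ?w (x i))
      * indicator {x. \<gamma> < (\<Sum>j<d. x j)} x \<partial>PiM {..<d} (\<lambda>_. pareto_law \<alpha>))"
    by (intro arg_cong2[where f = "(*)"] nn_integral_cong) (auto simp: indicator_def space_PiM)
  finally show ?thesis .
qed

text \<open>Count powers of \<open>\<gamma> powr \<alpha>\<close>: the \<open>d\<close> tail factors
  contribute \<open>- d\<close>, the weights \<open>d - 1\<close>, the large coordinate
  \<open>- 1\<close>, in total \<open>- 2\<close>. The square is kept explicit for comparison with
  the squared tail probability.\<close>

lemma second_moment_max_le_bound:
  assumes \<alpha>: "\<alpha> > 0" and d: "d \<ge> 2"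
  shows "\<exists>C\<ge>0. \<forall>\<gamma>\<ge>1. second_moment_max_le \<alpha> d \<gamma> \<le> ennreal (C * (\<gamma> powr (- \<alpha>))\<^sup>2)"
proof -
  obtain K where K: "\<And>y. y > 0 \<Longrightarrow> pareto_conv_tail \<alpha> d y \<le> K * y powr (- \<alpha>)"
    using pareto_conv_tail_le[OF \<alpha>] by blast
  have T0: "0 \<le> pareto_conv_tail \<alpha> d y" for y
    by (simp add: pareto_conv_tail_eq[OF \<alpha>])
  \<comment> \<open>Evaluation at 1, where the power equals 1; the sign is needed to raise
    \<open>K\<close> to the power \<open>d\<close>.\<close>
  have "0 \<le> K" using T0[of 1] K[of 1] by simp
  define c where "c = d * real (d - 1) powr (1 + \<alpha>) * d powr \<alpha>"
  have "0 \<le> c" by (simp add: c_def)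
  show ?thesis
  proof (intro exI[of _ "K ^ d * c"] conjI allI impI)
    show "0 \<le> K ^ d * c" using \<open>0 \<le> K\<close> \<open>0 \<le> c\<close> by simp
  next
    fix \<gamma> :: real assume \<gamma>: "\<gamma> \<ge> 1"
    obtain m where m: "d = Suc m" using d by (cases d) auto
    let ?u = "\<gamma> powr \<alpha>"
    have u: "?u > 0" "\<gamma> powr (- \<alpha>) = 1 / ?u" using \<gamma> by (auto simp: powr_minus_divide)
    have "second_moment_max_le \<alpha> d \<gamma>
      \<le> ennreal (pareto_conv_tail \<alpha> d \<gamma> ^ d) * ennreal (c * ?u ^ (d - 1) * \<gamma> powr (- \<alpha>))"
      unfolding c_def
      by (rule order_trans[OF second_moment_max_le_le_weights[OF \<alpha> d]
          mult_left_mono[OF nn_integral_pareto_weights_le[OF \<alpha> d \<gamma>]]]) simp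
    also have "\<dots> = ennreal (pareto_conv_tail \<alpha> d \<gamma> ^ d * (c * ?u ^ (d - 1) * \<gamma> powr (- \<alpha>)))"
      using T0 \<open>0 \<le> c\<close> by (intro ennreal_mult[symmetric]) auto
    also have "\<dots> \<le> ennreal ((K * \<gamma> powr (- \<alpha>)) ^ d * (c * ?u ^ (d - 1) * \<gamma> powr (- \<alpha>)))"
      using \<gamma> T0 \<open>0 \<le> c\<close> by (intro ennreal_leI mult_right_mono power_mono K) auto
    \<comment> \<open>One of the \<open>d = Suc m\<close> factors \<open>1 / ?u\<close> joins the
      trailing \<open>\<gamma> powr (- \<alpha>)\<close> to form the square; the other
      \<open>m\<close> cancel against the weights.\<close>
    also have "(K * \<gamma> powr (- \<alpha>)) ^ d * (c * ?u ^ (d - 1) * \<gamma> powr (- \<alpha>))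
      = K ^ d * c * (\<gamma> powr (- \<alpha>))\<^sup>2 * ((1 / ?u) ^ m * ?u ^ m)"
      unfolding u(2) by (simp only: m power_mult_distrib) (simp add: power2_eq_square)
    also have "(1 / ?u) ^ m * ?u ^ m = 1"
      using u(1) by (simp add: power_mult_distrib[symmetric])
    finally show "second_moment_max_le \<alpha> d \<gamma> \<le> ennreal (K ^ d * c * (\<gamma> powr (- \<alpha>))\<^sup>2)"
      by simp
  qed
qed

section \<open>Comparison with the tail probability and passage to the limit\<close>

theorem proposition2:
  fixes M :: "'a measure" and X :: "nat \<Rightarrow> 'a \<Rightarrow> real" and d :: nat and \<alpha> :: real
  assumes "d \<ge> 2" and "\<alpha> > 0"
    and "prob_space M"
    and "prob_space.indep_vars M (\<lambda>_. borel) X {..<d}"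
    and "\<And>i. i < d \<Longrightarrow> distributed M lborel (X i) (\<lambda>x. ennreal (pareto_density \<alpha> x))"
  shows "\<forall>\<epsilon>>0. Limsup at_top (\<lambda>\<gamma>::real.
           second_moment_max_le \<alpha> d \<gamma>
             / ennreal (measure M {\<omega> \<in> space M. (\<Sum>i<d. X i \<omega>) > \<gamma>} powr (2 - \<epsilon>))) = 0"
proof (intro allI impI)
  fix \<epsilon> :: real assume \<epsilon>: "\<epsilon> > 0"
  interpret prob_space M by fact
  define l where "l \<gamma> = prob {\<omega> \<in> space M. (\<Sum>i<d. X i \<omega>) > \<gamma>}" for \<gamma>
  have X [measurable]: "X i \<in> borel_measurable M" if "i < d" for i
    using distributed_measurable[OF assms(5)[OF that]] by simp
  have law: "distr M borel (X i) = pareto_law \<alpha>" if "i < d" for i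
    using distributed_distr_eq_density[OF assms(5)[OF that]]
    by (simp add: pareto_law_def distr_cong[OF refl sets_lborel refl])
  have AE_ge1: "AE \<omega> in M. \<forall>i<d. 1 \<le> X i \<omega>"
  proof (subst AE_all_countable, intro allI)
    fix i show "AE \<omega> in M. i < d \<longrightarrow> 1 \<le> X i \<omega>"
    proof (cases "i < d")
      case True
      have "AE x in distr M borel (X i). 1 \<le> x"
        unfolding law[OF True] by (rule AE_pareto_law_ge_1[OF assms(2)])
      then have "AE \<omega> in M. 1 \<le> X i \<omega>"
        by (rule AE_distrD[OF X[OF True]])
      then show ?thesis by simp
    qed simp
  qed
  \<comment> \<open>Almost surely all jumps are positive, so \<open>X 0\<close> alone above
    \<open>\<gamma>\<close> suffices. This lower bound links \<open>l\<close> to the second moment: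
    both are compared with powers of \<open>\<gamma> powr (- \<alpha>)\<close>.\<close>
  have l_ge: "\<gamma> powr (- \<alpha>) \<le> l \<gamma>" if "\<gamma> \<ge> 1" for \<gamma>
  proof -
    have "\<gamma> powr (- \<alpha>) = measure (distr M borel (X 0)) {\<gamma><..}"
      using that assms(1,2) by (simp add: law measure_pareto_law_greaterThan)
    also have "\<dots> = prob {\<omega> \<in> space M. \<gamma> < X 0 \<omega>}"
      using X[of 0] assms(1) by (subst measure_distr) (auto intro!: arg_cong[where f = prob])
    also have "\<dots> \<le> l \<gamma>"
      unfolding l_def
    proof (intro finite_measure_mono_AE)
      show "AE \<omega> in M. \<omega> \<in> {\<omega> \<in> space M. \<gamma> < X 0 \<omega>} \<longrightarrow> \<omega> \<in> {\<omega> \<in> space M. \<gamma> < (\<Sum>i<d. X i \<omega>)}"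
        using AE_ge1
      proof eventually_elim
        fix \<omega> assume ge1: "\<forall>i<d. 1 \<le> X i \<omega>"
        have "0 \<le> X i \<omega>" if "i < d" for i
          using ge1[rule_format, OF that] by simp
        then have "X 0 \<omega> \<le> (\<Sum>i<d. X i \<omega>)"
          using assms(1) by (intro member_le_sum) auto
        then show "\<omega> \<in> {\<omega> \<in> space M. \<gamma> < X 0 \<omega>} \<longrightarrow> \<omega> \<in> {\<omega> \<in> space M. \<gamma> < (\<Sum>i<d. X i \<omega>)}"
          by auto
      qed
    qed measurable
    finally show ?thesis .
  qed
  \<comment> \<open>The upper bound serves only to show that \<open>l\<close>, and hence
    \<open>l \<gamma> powr \<epsilon>\<close>, tends to 0.\<close>
  have "l \<gamma> \<le> d powr (1 + \<alpha>) * \<gamma> powr (- \<alpha>)" if "\<gamma> \<ge> 1" for \<gamma>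
    using prob_sum_pareto_greater_le[OF \<open>\<alpha> > 0\<close>, of "{..<d}" X \<gamma>] assms(1) law that
    by (auto simp: l_def lessThan_empty_iff)
  then have "(l \<longlongrightarrow> 0) at_top"
    using assms(2)
    by (intro tendsto_sandwich[OF _ _ tendsto_const
          tendsto_mult_right_zero[OF tendsto_neg_powr[OF _ filterlim_ident]]])
       (auto simp: l_def intro!: eventually_at_top_linorderI[of 1])
  from tendsto_zero_powrI[OF this tendsto_const _ \<epsilon>]
  have l_tendsto: "((\<lambda>\<gamma>. l \<gamma> powr \<epsilon>) \<longlongrightarrow> 0) at_top"
    by (simp add: l_def)
  obtain C where C: "C \<ge> 0"
    "\<forall>\<gamma>\<ge>1. second_moment_max_le \<alpha> d \<gamma> \<le> ennreal (C * (\<gamma> powr (- \<alpha>))\<^sup>2)"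
    using second_moment_max_le_bound[OF assms(2,1)] by blast
  \<comment> \<open>Replacing \<open>\<gamma> powr (- \<alpha>)\<close> by the larger
    \<open>l \<gamma>\<close> bounds the numerator by \<open>C * (l \<gamma>)^2\<close>; division by
    \<open>l \<gamma> powr (2 - \<epsilon>)\<close> leaves the vanishing factor
    \<open>l \<gamma> powr \<epsilon>\<close>.\<close>
  have le: "second_moment_max_le \<alpha> d \<gamma> / ennreal (l \<gamma> powr (2 - \<epsilon>)) \<le> ennreal (C * l \<gamma> powr \<epsilon>)"
    if "\<gamma> \<ge> 1" for \<gamma>
  proof -
    have l: "l \<gamma> > 0" by (rule less_le_trans[OF _ l_ge[OF that]]) (use that in simp)
    have "second_moment_max_le \<alpha> d \<gamma> \<le> ennreal (C * (l \<gamma>)\<^sup>2)"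
      using C(1) l_ge[OF that]
      by (intro order_trans[OF C(2)[rule_format, OF that]] ennreal_leI mult_left_mono power_mono) auto
    then have "second_moment_max_le \<alpha> d \<gamma> / ennreal (l \<gamma> powr (2 - \<epsilon>))
      \<le> ennreal (C * (l \<gamma>)\<^sup>2) / ennreal (l \<gamma> powr (2 - \<epsilon>))"
      by (rule divide_right_mono_ennreal)
    also have "\<dots> = ennreal (C * l \<gamma> powr \<epsilon>)"
      using l C(1) by (simp add: divide_ennreal powr_diff)
    finally show ?thesis .
  qed
  have "((\<lambda>\<gamma>. ennreal (C * l \<gamma> powr \<epsilon>)) \<longlongrightarrow> ennreal 0) at_top"
    by (intro tendsto_ennrealI tendsto_mult_right_zero l_tendsto)
  then have upper: "((\<lambda>\<gamma>. ennreal (C * l \<gamma> powr \<epsilon>)) \<longlongrightarrow> 0) at_top" by simp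
  have "((\<lambda>\<gamma>. second_moment_max_le \<alpha> d \<gamma> / ennreal (l \<gamma> powr (2 - \<epsilon>))) \<longlongrightarrow> 0) at_top"
    by (rule tendsto_sandwich[OF always_eventually
          eventually_at_top_linorderI[of 1, OF le] tendsto_const upper]) simp_all
  then show "Limsup at_top (\<lambda>\<gamma>::real. second_moment_max_le \<alpha> d \<gamma>
      / ennreal (prob {\<omega> \<in> space M. (\<Sum>i<d. X i \<omega>) > \<gamma>} powr (2 - \<epsilon>))) = 0"
    unfolding l_def by (intro lim_imp_Limsup) auto
qed

end
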